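(* Let $M\in\mathbb{R}^{m\times n}$ and let $p\in[2,\infty]$, $q\in[1,2]$ be a conjugate pair. Consider the two problems $$\text{(ball)}\quad\min_{\|Z\|_{S_p}\le1}\langle M,Z\rangle,\qquad\text{(regularization)}\quad\min_{Z\in\mathbb{R}^{m\times n}}\Big\{\langle M,Z\rangle+\frac12\|Z\|_{S_p}^2\Big\}.$$ If $M=0$, then $Z=0$ is a minimizer of both problems. If $M\ne0$, then $$Z_{\rm b}:=-\frac{M(M^TM)^{\frac{q-2}{2}}}{\|M\|_{S_q}^{q-1}}$$ is a minimizer of the ball problem, and $Z_{\rm r}:=\|M\|_{S_q}\cdot Z_{\rm b}$ is a minimizer of the regularization problem.
   Context: $\|Z\|_{S_r}$ is the Schatten-$r$ norm (the $\ell_r$ norm of the vector of singular values), $r\in[1,\infty]$. $p,q$ are conjugate if $1/p+1/q=1$ with $1/\infty:=0$. $\langle\cdot,\cdot\rangle$ is the trace inner product. For a positive semidefinite matrix $A=U\mathrm{diag}(\sigma_1,\dots,\sigma_d)U^T$ ($U$ orthogonal) and $a\ge0$, $A^a:=U\mathrm{diag}(\sigma_1^a,\dots,\sigma_d^a)U^T$; for $a<0$, $A^a:=(A^+)^{-a}$, where $A^+$ is the Moore–Penrose pseudoinverse. *)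

theory Defs
  imports "HOL-Analysis.Analysis" "HOL-Computational_Algebra.Polynomial"
begin

definition trace_inner :: "real ^ 'n ^ 'm \<Rightarrow> real ^ 'n ^ 'm \<Rightarrow> real" where
  "trace_inner A B = trace (transpose A ** B)"

definition diag_matrix :: "real ^ 'n \<Rightarrow> real ^ 'n ^ 'n" where
  "diag_matrix s = (\<chi> i j. if i = j then s $ i else 0)"

text \<open>The determinant of \<open>x I - A\<close>, computed over the ring of polynomials in \<open>x\<close>.\<close>

definition charpoly :: "real ^ 'n ^ 'n \<Rightarrow> real poly" where
  "charpoly A = det (\<chi> i j. (if i = j then [:0, 1:] else 0) - [:A $ i $ j:])"

text \<open>The singular values are the square roots of the eigenvalues of \<open>A\<^sup>T A\<close>, listed with
  multiplicity in nonincreasing order. There are \<open>CARD('n)\<close> of them; if \<open>A\<close> has fewer rows than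
  columns, this includes extra zeros compared with the convention listing only
  \<open>min (CARD('m)) (CARD('n))\<close> values. These zeros affect none of the norms below.\<close>

definition singular_values :: "real ^ 'n ^ 'm \<Rightarrow> real list" where
  "singular_values A =
     rev (sorted_list_of_multiset (image_mset sqrt (proots (charpoly (transpose A ** A)))))"

definition lr_norm :: "ereal \<Rightarrow> real list \<Rightarrow> real" where
  "lr_norm r xs =
     (if r = \<infinity> then Max ((\<lambda>x. \<bar>x\<bar>) ` set xs)
      else (\<Sum>x\<leftarrow>xs. \<bar>x\<bar> powr real_of_ereal r) powr (1 / real_of_ereal r))"

definition schatten_norm :: "ereal \<Rightarrow> real ^ 'n ^ 'm \<Rightarrow> real" where
  "schatten_norm r A = lr_norm r (singular_values A)"

text \<open>The Moore--Penrose pseudoinverse, given by the four Penrose equations.\<close>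

definition pinv :: "real ^ 'n ^ 'm \<Rightarrow> real ^ 'm ^ 'n" where
  "pinv A = (THE B. A ** B ** A = A \<and> B ** A ** B = B \<and>
     transpose (A ** B) = A ** B \<and> transpose (B ** A) = B ** A)"

text \<open>\<open>powr\<close> has \<open>0 powr 0 = 0\<close>, whereas here \<open>0\<^sup>0 = 1\<close>, so that \<open>A\<^sup>0\<close> is the identity matrix.\<close>

definition real_pow :: "real \<Rightarrow> real \<Rightarrow> real" where
  "real_pow x a = (if a = 0 then 1 else x powr a)"

definition psd_pow_nonneg :: "real ^ 'n ^ 'n \<Rightarrow> real \<Rightarrow> real ^ 'n ^ 'n" where
  "psd_pow_nonneg A a = (THE B. \<exists>U s. orthogonal_matrix U \<and> (\<forall>i. 0 \<le> s $ i) \<and>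
     A = U ** diag_matrix s ** transpose U \<and>
     B = U ** diag_matrix (\<chi> i. real_pow (s $ i) a) ** transpose U)"

text \<open>Meaningful for positive semidefinite \<open>A\<close> only.\<close>

definition psd_pow :: "real ^ 'n ^ 'n \<Rightarrow> real \<Rightarrow> real ^ 'n ^ 'n" where
  "psd_pow A a = (if 0 \<le> a then psd_pow_nonneg A a else psd_pow_nonneg (pinv A) (- a))"

end

theory Submission
  imports Defs
begin

text \<open>Both claims follow from Hoelder's inequality \<open>\<langle>M, Z\<rangle> \<ge> - \<parallel>M\<parallel>\<^sub>q \<parallel>Z\<parallel>\<^sub>p\<close> for Schatten norms. The point
  \<open>Zb\<close> lies on the unit sphere and attains \<open>- \<parallel>M\<parallel>\<^sub>q\<close>. The regularized objective is at least
  \<open>- \<parallel>M\<parallel>\<^sub>q \<parallel>Z\<parallel>\<^sub>p + \<parallel>Z\<parallel>\<^sub>p\<^sup>2 / 2 \<ge> - \<parallel>M\<parallel>\<^sub>q\<^sup>2 / 2\<close>, with equality at \<open>Zr\<close>. Since \<open>p \<ge> 2\<close>, Hoelder's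
  inequality needs neither singular value decompositions nor von Neumann's trace inequality:
  the spectral theorem for \<open>M\<^sup>T M\<close> and \<open>Z\<^sup>T Z\<close> suffices.\<close>

subsection \<open>The spectral theorem for real symmetric matrices\<close>

lemma symmetric_matrix_inner:
  fixes A :: "real ^ 'n ^ 'n"
  assumes "transpose A = A"
  shows "x \<bullet> (A *v y) = (A *v x) \<bullet> y"
  by (metis assms dot_lmul_matrix transpose_matrix_vector)

text \<open>The eigenvector maximizes the Rayleigh quotient on \<open>S\<close>: with the maximum \<open>l\<close>, the form
  \<open>g x = l (x \<bullet> x) - x \<bullet> A x\<close> is nonnegative on \<open>S\<close> and vanishes at \<open>v\<close>, so its first variation
  at \<open>v\<close> vanishes on \<open>S\<close>.\<close>

lemma symmetric_matrix_eigenvector_in_subspace: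
  fixes A :: "real ^ 'n ^ 'n"
  assumes sym: "transpose A = A" and S: "subspace S" and inv: "\<And>x. x \<in> S \<Longrightarrow> A *v x \<in> S"
    and ne: "S \<noteq> {0}"
  obtains v l where "v \<in> S" "norm v = 1" "A *v v = l *\<^sub>R v"
proof -
  define K where "K = S \<inter> sphere 0 1"
  have cK: "compact K"
    unfolding K_def using closed_subspace[OF S] by (simp add: closed_Int_compact)
  obtain x where x: "x \<in> S" "x \<noteq> 0" using ne S subspace_0 by blast
  then have "x /\<^sub>R norm x \<in> K"
    using S by (simp add: K_def subspace_scale)
  then have neK: "K \<noteq> {}" by blast
  have cont: "continuous_on K (\<lambda>x. x \<bullet> (A *v x))"
    by (intro continuous_on_inner[OF continuous_on_id] matrix_vector_mult_linear_continuous_on)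
  obtain v where v: "v \<in> K" and mx: "\<And>x. x \<in> K \<Longrightarrow> x \<bullet> (A *v x) \<le> v \<bullet> (A *v v)"
    using continuous_attains_sup[OF cK neK cont] by blast
  define l where "l = v \<bullet> (A *v v)"
  have vS: "v \<in> S" and nv: "norm v = 1" using v by (auto simp: K_def)
  have g: "0 \<le> l * (x \<bullet> x) - x \<bullet> (A *v x)" if "x \<in> S" for x
  proof (cases "x = 0")
    case False
    then have "x /\<^sub>R norm x \<in> K"
      using S that by (simp add: K_def subspace_scale)
    from mx[OF this] have "(x \<bullet> (A *v x)) / (norm x)\<^sup>2 \<le> l"
      by (simp add: matrix_vector_mult_scaleR l_def power2_eq_square field_simps)
    then show ?thesis
      using False by (simp add: divide_le_eq power2_norm_eq_inner)
  qed simp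
  have var: "w \<bullet> (l *\<^sub>R v - A *v v) = 0" if w: "w \<in> S" for w
  proof -
    define b where "b = w \<bullet> (l *\<^sub>R v - A *v v)"
    define c where "c = l * (w \<bullet> w) - w \<bullet> (A *v w)"
    have q: "0 \<le> 2 * t * b + t\<^sup>2 * c" for t
    proof -
      have "v + t *\<^sub>R w \<in> S" using S vS w by (simp add: subspace_add subspace_scale)
      from g[OF this] have "0 \<le> l * ((v + t *\<^sub>R w) \<bullet> (v + t *\<^sub>R w)) - (v + t *\<^sub>R w) \<bullet> (A *v (v + t *\<^sub>R w))" .
      also have "\<dots> = 2 * t * b + t\<^sup>2 * c"
      proof -
        have "v \<bullet> (A *v w) = w \<bullet> (A *v v)"
          using symmetric_matrix_inner[OF sym, of v w] by (simp add: inner_commute)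
        moreover have "v \<bullet> v = 1" using nv by (simp add: norm_eq_1)
        ultimately show ?thesis
          by (simp add: b_def c_def matrix_vector_right_distrib matrix_vector_mult_scaleR
              inner_add_left inner_add_right inner_diff_right l_def[symmetric] inner_commute[of w v]
              algebra_simps power2_eq_square)
      qed
      finally show ?thesis .
    qed
    have c0: "0 \<le> c" using g[OF w] by (simp add: c_def)
    \<comment> \<open>Minimizes the quadratic with \<open>c + 1\<close> in place of
      \<open>c\<close>; the added 1 keeps the denominator positive when
      \<open>c = 0\<close>.\<close>
    define t where "t = - b / (c + 1)"
    have t: "t * (c + 1) = - b" using c0 by (simp add: t_def)
    have "0 \<le> 2 * t * b + t\<^sup>2 * c" by (rule q)
    also have "\<dots> \<le> 2 * t * b + t * (t * (c + 1))" by (simp add: power2_eq_square algebra_simps)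
    also have "\<dots> = - (b\<^sup>2 / (c + 1))" unfolding t by (simp add: t_def power2_eq_square)
    finally have "b\<^sup>2 \<le> 0" using c0 by (simp add: divide_le_0_iff)
    then show ?thesis by (simp add: b_def)
  qed
  have "l *\<^sub>R v - A *v v \<in> S" using S vS inv by (simp add: subspace_diff subspace_scale)
  from var[OF this] have "A *v v = l *\<^sub>R v" by simp
  then show ?thesis using that vS nv by blast
qed

text \<open>A largest orthonormal set \<open>B\<close> of eigenvectors must span: its orthogonal
  complement is invariant under \<open>A\<close> by symmetry, so if it were nonzero it would contain
  one more unit eigenvector.\<close>

lemma symmetric_matrix_orthonormal_eigenbasis:
  fixes A :: "real ^ 'n ^ 'n"
  assumes sym: "transpose A = A"
  obtains B where "pairwise orthogonal B" "\<And>v. v \<in> B \<Longrightarrow> norm v = 1"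
    "\<And>v. v \<in> B \<Longrightarrow> \<exists>l. A *v v = l *\<^sub>R v" "card B = CARD('n)"
proof -
  define good where "good B \<longleftrightarrow> pairwise orthogonal B \<and>
     (\<forall>v\<in>B. norm v = 1 \<and> (\<exists>l. A *v v = l *\<^sub>R v))" for B
  have ind: "independent B" if "good B" for B
    using that by (intro pairwise_orthogonal_independent) (auto simp: good_def)
  have card_le: "finite B \<and> card B \<le> CARD('n)" if "good B" for B
    using independent_bound[OF ind[OF that]] by simp
  have "good {}" by (simp add: good_def)
  \<comment> \<open>Orthonormal sets are independent, so the dimension bounds their size and a
    largest one exists.\<close>
  then obtain B where B: "good B" and mx: "\<And>C. good C \<Longrightarrow> card C \<le> card B"
    using ex_has_greatest_nat[of good "{}" card "CARD('n) + 1"] card_le by (metis le_imp_less_Suc Suc_eq_plus1)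
  define S where "S = {y. \<forall>x\<in>B. orthogonal x y}"
  have "S = {0}"
  proof (rule ccontr)
    assume ne: "S \<noteq> {0}"
    have sub: "subspace S" unfolding S_def by (rule subspace_orthogonal_to_vectors)
    have "A *v y \<in> S" if "y \<in> S" for y
      unfolding S_def
    proof (intro CollectI ballI)
      fix x assume x: "x \<in> B"
      then obtain l where "A *v x = l *\<^sub>R x" using B by (auto simp: good_def)
      then show "orthogonal x (A *v y)"
        using that x by (simp add: orthogonal_def symmetric_matrix_inner[OF sym] S_def)
    qed
    then obtain v l where v: "v \<in> S" "norm v = 1" "A *v v = l *\<^sub>R v"
      using symmetric_matrix_eigenvector_in_subspace[OF sym sub _ ne] by metis
    have "v \<notin> B" using v by (auto simp: S_def orthogonal_def norm_eq_1)
    moreover have "good (insert v B)"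
      using B v by (auto simp: good_def pairwise_insert S_def orthogonal_commute)
    ultimately show False
      using mx[of "insert v B"] card_le[OF B] by simp
  qed
  \<comment> \<open>\<open>B\<close> and \<open>span B\<close> have the same orthogonal complement,
    so the dimension formula turns \<open>S = {0}\<close> into
    \<open>dim (span B) = CARD('n)\<close>.\<close>
  moreover have "S = {y \<in> UNIV. \<forall>x\<in>span B. orthogonal x y}"
    unfolding S_def by (auto intro: orthogonal_to_span span_base simp: orthogonal_commute)
  then have "dim S + dim (span B) = CARD('n)"
    using dim_subspace_orthogonal_to_vectors[of "span B" UNIV] by simp
  ultimately have "card B = CARD('n)"
    using dim_eq_card_independent[OF ind[OF B]] by (simp add: dim_span)
  then show ?thesis using that B by (auto simp: good_def)
qed

lemma diag_matrix_mult_nth: "(U ** diag_matrix s) $ i $ j = U $ i $ j * s $ j"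
  by (simp add: diag_matrix_def matrix_matrix_mult_def if_distrib cong: if_cong)

lemma diag_matrix_mult_nth_left: "(diag_matrix s ** U) $ i $ j = s $ i * U $ i $ j"
  by (simp add: diag_matrix_def matrix_matrix_mult_def if_distrib if_distribR cong: if_cong)

theorem symmetric_matrix_diagonalization:
  fixes A :: "real ^ 'n ^ 'n"
  assumes sym: "transpose A = A"
  obtains U s where "orthogonal_matrix U" "A = U ** diag_matrix s ** transpose U"
proof -
  obtain B where B: "pairwise orthogonal B" "\<And>v. v \<in> B \<Longrightarrow> norm v = 1"
    "\<And>v. v \<in> B \<Longrightarrow> \<exists>l. A *v v = l *\<^sub>R v" "card B = CARD('n)"
    using symmetric_matrix_orthonormal_eigenbasis[OF sym] by metis
  then have "finite B" by (simp add: card_ge_0_finite)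
  then obtain f :: "'n \<Rightarrow> _" where f: "bij_betw f UNIV B"
    using B(4) by (metis finite_same_card_bij finite_class.finite_UNIV)
  then have fB: "f i \<in> B" for i by (auto simp: bij_betw_def)
  have "\<forall>i. \<exists>l. A *v f i = l *\<^sub>R f i" using B(3) fB by blast
  then obtain l where l: "\<And>i. A *v f i = l i *\<^sub>R f i" by metis
  define U where "U = (\<chi> i j. f j $ i)"
  have col: "column j U = f j" for j by (simp add: U_def column_def)
  have "orthogonal (f i) (f j)" if "i \<noteq> j" for i j
    using pairwiseD[OF B(1) fB fB] f that by (auto simp: bij_betw_def inj_eq)
  then have U: "orthogonal_matrix U"
    using B(2) fB by (simp add: orthogonal_matrix_orthonormal_columns col)
  have "(A ** U) $ i $ j = (U ** diag_matrix (\<chi> i. l i)) $ i $ j" for i j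
  proof -
    have "(A ** U) $ i $ j = (A *v f j) $ i"
      by (simp add: matrix_matrix_mult_def matrix_vector_mult_def U_def)
    then show ?thesis by (simp add: l diag_matrix_mult_nth U_def)
  qed
  then have "A ** U = U ** diag_matrix (\<chi> i. l i)" by (simp add: vec_eq_iff)
  then have "A = U ** diag_matrix (\<chi> i. l i) ** transpose U"
    using U by (metis matrix_mul_assoc matrix_mul_rid orthogonal_matrix_def)
  then show ?thesis using that U by blast
qed

subsection \<open>Functions of symmetric matrices\<close>

text \<open>Products of vectors such as \<open>s * t\<close> are componentwise, so for a fixed
  orthogonal \<open>U\<close> matrix products become products of spectra.\<close>

definition spectral :: "real ^ 'n ^ 'n \<Rightarrow> real ^ 'n \<Rightarrow> real ^ 'n ^ 'n" where
  "spectral U s = U ** diag_matrix s ** transpose U"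

lemma diag_matrix_mult: "diag_matrix s ** diag_matrix t = diag_matrix (s * t)"
  by (simp add: vec_eq_iff diag_matrix_mult_nth) (simp add: diag_matrix_def)

lemma transpose_diag_matrix [simp]: "transpose (diag_matrix s) = diag_matrix s"
  by (auto simp: transpose_def diag_matrix_def vec_eq_iff)

lemma orthogonal_matrix_cancel:
  assumes "orthogonal_matrix U"
  shows "transpose U ** U = mat 1" "U ** transpose U = mat 1"
    "transpose U ** (U ** A) = A" "U ** (transpose U ** B) = B"
  using assms by (simp_all add: orthogonal_matrix_def matrix_mul_assoc)

lemma spectral_mult:
  assumes "orthogonal_matrix U"
  shows "spectral U s ** spectral U t = spectral U (s * t)"
  by (simp add: spectral_def orthogonal_matrix_cancel[OF assms] flip: matrix_mul_assoc diag_matrix_mult)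

lemma transpose_spectral [simp]: "transpose (spectral U s) = spectral U s"
  by (simp add: spectral_def matrix_transpose_mul matrix_mul_assoc)

lemma scaleR_spectral: "c *\<^sub>R spectral U s = spectral U (c *\<^sub>R s)"
proof -
  have "c *\<^sub>R diag_matrix s = diag_matrix (c *\<^sub>R s)"
    by (simp add: diag_matrix_def vec_eq_iff)
  then show ?thesis
    by (simp add: spectral_def scalar_matrix_assoc flip: matrix_scalar_ac)
qed

lemma trace_spectral:
  assumes "orthogonal_matrix U"
  shows "trace (spectral U s) = (\<Sum>i\<in>UNIV. s $ i)"
proof -
  have "trace (spectral U s) = trace (transpose U ** (U ** diag_matrix s))"
    unfolding spectral_def by (rule trace_mul_sym)
  then show ?thesis
    by (simp add: orthogonal_matrix_cancel[OF assms]) (simp add: trace_def diag_matrix_def)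
qed

text \<open>With \<open>W = V\<^sup>T U\<close> the hypothesis reads \<open>W D(s) = D(t) W\<close>, that is,
  \<open>W\<^sub>i\<^sub>j \<noteq> 0\<close> only if \<open>s\<^sub>j = t\<^sub>i\<close>; hence \<open>W\<close> intertwines every function of \<open>s\<close> and \<open>t\<close>.\<close>

lemma spectral_map_eq:
  assumes U: "orthogonal_matrix U" and V: "orthogonal_matrix V" and eq: "spectral U s = spectral V t"
  shows "spectral U (\<chi> i. f (s $ i)) = spectral V (\<chi> i. f (t $ i))"
proof -
  define W where "W = transpose V ** U"
  have "transpose V ** (spectral U s) ** U = transpose V ** (spectral V t) ** U"
    using eq by simp
  then have "W ** diag_matrix s = diag_matrix t ** W"
    by (simp add: spectral_def W_def orthogonal_matrix_cancel[OF U] orthogonal_matrix_cancel[OF V]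
        flip: matrix_mul_assoc)
  then have "W $ i $ j * s $ j = t $ i * W $ i $ j" for i j
    by (metis diag_matrix_mult_nth diag_matrix_mult_nth_left)
  then have "W $ i $ j = 0 \<or> s $ j = t $ i" for i j
    by (metis mult.commute mult_right_cancel)
  then have "W ** diag_matrix (\<chi> i. f (s $ i)) = diag_matrix (\<chi> i. f (t $ i)) ** W"
    by (auto simp: vec_eq_iff diag_matrix_mult_nth diag_matrix_mult_nth_left)
       (metis mult.commute mult_zero_left)
  then have "V ** (W ** diag_matrix (\<chi> i. f (s $ i))) ** transpose U
           = V ** (diag_matrix (\<chi> i. f (t $ i)) ** W) ** transpose U"
    by simp
  then show ?thesis
    by (simp add: spectral_def W_def orthogonal_matrix_cancel[OF U] orthogonal_matrix_cancel[OF V]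
        flip: matrix_mul_assoc)
qed

text \<open>The definite description is well defined because, by \<open>spectral_map_eq\<close>,
  every diagonalization of the matrix yields the same power.\<close>

lemma psd_pow_nonneg_spectral:
  assumes U: "orthogonal_matrix U" and s: "\<And>i. 0 \<le> s $ i"
  shows "psd_pow_nonneg (spectral U s) a = spectral U (\<chi> i. real_pow (s $ i) a)"
  unfolding psd_pow_nonneg_def spectral_def[symmetric]
proof (rule the_equality)
  show "\<exists>V t. orthogonal_matrix V \<and> (\<forall>i. 0 \<le> t $ i) \<and> spectral U s = spectral V t \<and>
      spectral U (\<chi> i. real_pow (s $ i) a) = spectral V (\<chi> i. real_pow (t $ i) a)"
    using U s by blast
next
  fix B
  assume "\<exists>V t. orthogonal_matrix V \<and> (\<forall>i. 0 \<le> t $ i) \<and> spectral U s = spectral V t \<and>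
      B = spectral V (\<chi> i. real_pow (t $ i) a)"
  then obtain V t where "orthogonal_matrix V" "spectral U s = spectral V t"
      "B = spectral V (\<chi> i. real_pow (t $ i) a)"
    by blast
  then show "B = spectral U (\<chi> i. real_pow (s $ i) a)"
    using spectral_map_eq[OF U, of V s t "\<lambda>x. real_pow x a"] by simp
qed

text \<open>Penrose's argument: \<open>A ** B = A ** C\<close> and \<open>B ** A = C ** A\<close>
  follow by transposing products of these symmetric projections, and then
  \<open>B = B A B = C A B = C A C = C\<close>.\<close>

lemma pinv_unique:
  fixes A :: "real ^ 'n ^ 'm"
  assumes B: "A ** B ** A = A" "B ** A ** B = B" "transpose (A ** B) = A ** B" "transpose (B ** A) = B ** A"
    and C: "A ** C ** A = A" "C ** A ** C = C" "transpose (A ** C) = A ** C" "transpose (C ** A) = C ** A"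
  shows "B = C"
proof -
  have AB: "A ** B = A ** C"
  proof -
    have "A ** B = transpose (A ** C ** A ** B)" using B C by simp
    also have "\<dots> = transpose (A ** B) ** transpose (A ** C)"
      by (simp add: matrix_transpose_mul matrix_mul_assoc)
    also have "\<dots> = (A ** B ** A) ** C" using B(3) C(3) by (simp add: matrix_mul_assoc)
    finally show ?thesis using B(1) by simp
  qed
  have BA: "B ** A = C ** A"
  proof -
    have "B ** A = transpose (B ** (A ** C ** A))" using B C by simp
    also have "\<dots> = transpose (C ** A) ** transpose (B ** A)"
      by (simp add: matrix_transpose_mul matrix_mul_assoc)
    also have "\<dots> = C ** (A ** B ** A)" using B(4) C(4) by (simp add: matrix_mul_assoc)
    finally show ?thesis using B(1) by simp
  qed
  have "B = C ** A ** B" using B(2) BA by simp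
  also have "\<dots> = C ** A ** C" using AB by (simp flip: matrix_mul_assoc)
  finally show ?thesis using C(2) by simp
qed

text \<open>Since \<open>inverse 0 = 0\<close>, entrywise inversion keeps zero eigenvalues at zero,
  exactly as the pseudoinverse does.\<close>

lemma pinv_spectral:
  assumes U: "orthogonal_matrix U"
  shows "pinv (spectral U s) = spectral U (\<chi> i. inverse (s $ i))"
proof -
  let ?B = "spectral U (\<chi> i. inverse (s $ i))"
  have "s * (\<chi> i. inverse (s $ i)) * s = s" "(\<chi> i. inverse (s $ i)) * s * (\<chi> i. inverse (s $ i)) = (\<chi> i. inverse (s $ i))"
    by (auto simp: vec_eq_iff) (metis left_inverse right_inverse)+
  then have *: "spectral U s ** ?B ** spectral U s = spectral U s" "?B ** spectral U s ** ?B = ?B"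
    "transpose (spectral U s ** ?B) = spectral U s ** ?B"
    "transpose (?B ** spectral U s) = ?B ** spectral U s"
    by (simp_all add: spectral_mult[OF U])
  show ?thesis
    unfolding pinv_def
  proof (rule the_equality)
    show "B = ?B" if "spectral U s ** B ** spectral U s = spectral U s \<and> B ** spectral U s ** B = B \<and>
      transpose (spectral U s ** B) = spectral U s ** B \<and> transpose (B ** spectral U s) = B ** spectral U s" for B
      using pinv_unique[of "spectral U s" B ?B] * that by blast
  qed (use * in blast)
qed

lemma psd_pow_spectral:
  assumes U: "orthogonal_matrix U" and s: "\<And>i. 0 \<le> s $ i"
  shows "psd_pow (spectral U s) a = spectral U (\<chi> i. real_pow (s $ i) a)"
proof (cases "0 \<le> a")
  case True
  then show ?thesis by (simp add: psd_pow_def psd_pow_nonneg_spectral[OF U s])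
next
  case False
  \<comment> \<open>At a zero eigenvalue both sides are 0, because \<open>a\<close> is nonzero; the
    pseudoinverse convention thus agrees with \<open>real_pow\<close> for negative
    exponents.\<close>
  have "real_pow (inverse (s $ i)) (- a) = real_pow (s $ i) a" for i
    using False s[of i] by (simp add: real_pow_def powr_minus inverse_powr)
  then show ?thesis
    using False s by (simp add: psd_pow_def pinv_spectral[OF U] psd_pow_nonneg_spectral[OF U])
qed

subsection \<open>Schatten norms through the Gram matrix\<close>

text \<open>Similarity invariance of the characteristic polynomial, carried out over the polynomial
  ring: \<open>P\<close> embeds real matrices as constant ones, and the scalar matrix
  \<open>X\<close> commutes with every matrix.\<close>

lemma charpoly_spectral:
  fixes U :: "real ^ 'n ^ 'n"
  assumes U: "orthogonal_matrix U"
  shows "charpoly (spectral U s) = (\<Prod>i\<in>UNIV. [:- s $ i, 1:])"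
proof -
  define P :: "real ^ 'n ^ 'n \<Rightarrow> real poly ^ 'n ^ 'n" where "P A = (\<chi> i j. [:A $ i $ j:])" for A
  have "(\<Sum>k\<in>K. [:f k:]) = [:\<Sum>k\<in>K. f k:]" for f :: "'n \<Rightarrow> real" and K
    by (induction K rule: infinite_finite_induct) simp_all
  then have P_mult: "P A ** P B = P (A ** B)" for A B
    by (simp add: P_def matrix_matrix_mult_def vec_eq_iff mult.commute)
  have P_one: "P (mat 1) = mat 1"
    by (simp add: P_def mat_def vec_eq_iff one_pCons)
  have UU: "P U ** P (transpose U) = mat 1"
    by (simp add: P_mult orthogonal_matrix_cancel[OF U] P_one)
  define X :: "real poly ^ 'n ^ 'n" where "X = (\<chi> i j. if i = j then [:0, 1:] else 0)"
  have X: "X ** A = A ** X" for A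
    by (simp add: X_def matrix_matrix_mult_def vec_eq_iff if_distrib if_distribR mult.commute cong: if_cong)
  have "X - P (spectral U s) = P U ** (X - P (diag_matrix s)) ** P (transpose U)"
  proof -
    have "P U ** (X - P (diag_matrix s)) ** P (transpose U)
       = P U ** X ** P (transpose U) - P U ** P (diag_matrix s) ** P (transpose U)"
      by (simp add: matrix_matrix_mult_def vec_eq_iff algebra_simps sum_subtractf)
    also have "P U ** X ** P (transpose U) = X"
      by (metis UU X matrix_mul_assoc matrix_mul_rid)
    finally show ?thesis by (simp add: P_mult spectral_def)
  qed
  then have "det (X - P (spectral U s)) = det (X - P (diag_matrix s)) * det (P U ** P (transpose U))"
    by (simp add: det_mul)
  also have "\<dots> = det (X - P (diag_matrix s))" by (simp add: UU)
  also have "\<dots> = (\<Prod>i\<in>UNIV. [:- s $ i, 1:])"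
    by (subst det_diagonal) (auto simp: X_def P_def diag_matrix_def)
  moreover have "charpoly (spectral U s) = det (X - P (spectral U s))"
    unfolding charpoly_def X_def P_def by (rule arg_cong[where f = det]) (simp add: vec_eq_iff)
  ultimately show ?thesis by simp
qed

definition vec_norm :: "ereal \<Rightarrow> real ^ 'n \<Rightarrow> real" where
  "vec_norm r t =
     (if r = \<infinity> then Max (range (\<lambda>i. \<bar>t $ i\<bar>))
      else (\<Sum>i\<in>UNIV. \<bar>t $ i\<bar> powr real_of_ereal r) powr (1 / real_of_ereal r))"

text \<open>A singular value decomposition without left singular vectors: the columns of
  \<open>U\<close> are right singular vectors, and \<open>t\<close> holds the singular values in any
  order.\<close>

definition gram_decomp :: "real ^ 'n ^ 'm \<Rightarrow> real ^ 'n ^ 'n \<Rightarrow> real ^ 'n \<Rightarrow> bool" where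
  "gram_decomp A U t \<longleftrightarrow> orthogonal_matrix U \<and> (\<forall>i. 0 \<le> t $ i) \<and>
     transpose A ** A = spectral U (t * t)"

text \<open>Multisets discard the sorting; by \<open>charpoly_spectral\<close> the roots are the
  squares of the \<open>t $ i\<close>.\<close>

lemma mset_singular_values:
  assumes "gram_decomp A U t"
  shows "mset (singular_values A) = image_mset (\<lambda>i. t $ i) (mset_set UNIV)"
proof -
  have U: "orthogonal_matrix U" and t: "\<And>i. 0 \<le> t $ i" and eq: "transpose A ** A = spectral U (t * t)"
    using assms by (auto simp: gram_decomp_def)
  have "proots (\<Prod>i\<in>UNIV. [:- (t * t) $ i, 1:]) = (\<Sum>i\<in>UNIV. proots [:- (t * t) $ i, 1:])"
    by (rule proots_prod) simp
  also have "\<dots> = image_mset (\<lambda>i. (t * t) $ i) (mset_set UNIV)"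
    by (simp add: sum_unfold_sum_mset)
  finally have "mset (singular_values A) = image_mset sqrt (image_mset (\<lambda>i. (t * t) $ i) (mset_set UNIV))"
    by (simp add: singular_values_def eq charpoly_spectral[OF U])
  also have "\<dots> = image_mset (\<lambda>i. t $ i) (mset_set UNIV)"
    using t by (simp add: multiset.map_comp o_def)
  finally show ?thesis .
qed

lemma schatten_norm_gram:
  assumes "gram_decomp A U t"
  shows "schatten_norm r A = vec_norm r t"
proof -
  note m = mset_singular_values[OF assms]
  have "set (singular_values A) = range (\<lambda>i. t $ i)"
    using arg_cong[OF m, of set_mset] by simp
  moreover have "(\<Sum>x\<leftarrow>singular_values A. f x) = (\<Sum>i\<in>UNIV. f (t $ i))" for f :: "real \<Rightarrow> real"
    using arg_cong[OF m, of "\<lambda>M. \<Sum>\<^sub># (image_mset f M)"]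
    by (simp add: sum_unfold_sum_mset multiset.map_comp o_def flip: sum_mset_sum_list)
  ultimately show ?thesis
    by (simp add: schatten_norm_def lr_norm_def vec_norm_def image_image)
qed

text \<open>The eigenvalues of the Gram matrix are the squared lengths of the columns of
  \<open>A ** U\<close>, hence nonnegative, and \<open>t\<close> collects their square
  roots.\<close>

lemma gram_decomp_exists:
  fixes A :: "real ^ 'n ^ 'm"
  obtains U t where "gram_decomp A U t"
proof -
  have "transpose (transpose A ** A) = transpose A ** A" by (simp add: matrix_transpose_mul)
  then obtain U s where U: "orthogonal_matrix U" and eq: "transpose A ** A = spectral U s"
    unfolding spectral_def by (rule symmetric_matrix_diagonalization)
  have "diag_matrix s = transpose U ** spectral U s ** U"
    by (simp add: spectral_def orthogonal_matrix_cancel[OF U] flip: matrix_mul_assoc)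
  also have "\<dots> = transpose (A ** U) ** (A ** U)"
    by (simp add: matrix_transpose_mul matrix_mul_assoc flip: eq)
  finally have D: "diag_matrix s = transpose (A ** U) ** (A ** U)" .
  have "s $ i = diag_matrix s $ i $ i" for i by (simp add: diag_matrix_def)
  then have s: "0 \<le> s $ i" for i by (simp add: D matrix_mult_transpose_dot_column)
  have "gram_decomp A U (\<chi> i. sqrt (s $ i))"
    using s by (simp add: gram_decomp_def U eq vec_eq_iff[of s] arg_cong[where f = "spectral U"] times_vec_def)
  then show ?thesis by (rule that)
qed

lemma gram_decomp_scaleR:
  assumes "gram_decomp A U t"
  shows "gram_decomp (c *\<^sub>R A) U (\<bar>c\<bar> *\<^sub>R t)"
proof -
  have "transpose (c *\<^sub>R A) ** (c *\<^sub>R A) = (c * c) *\<^sub>R (transpose A ** A)"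
    by (simp add: transpose_scalar matrix_scalar_ac flip: scalar_matrix_assoc)
  moreover have "(c * c) *\<^sub>R (t * t) = (\<bar>c\<bar> *\<^sub>R t) * (\<bar>c\<bar> *\<^sub>R t)"
    by (simp add: vec_eq_iff algebra_simps)
  ultimately show ?thesis
    using assms by (simp add: gram_decomp_def scaleR_spectral)
qed

subsection \<open>The \<open>\<ell>\<^sub>r\<close> norms of vectors\<close>

lemma vec_norm_nonneg: "0 \<le> vec_norm r t"
proof (cases "r = \<infinity>")
  case True
  have "0 \<le> \<bar>t $ undefined\<bar>" by simp
  also have "\<dots> \<le> Max (range (\<lambda>i. \<bar>t $ i\<bar>))" by (rule Max_ge) auto
  finally show ?thesis using True by (simp add: vec_norm_def)
qed (simp add: vec_norm_def)

lemma abs_le_vec_norm_infinity: "\<bar>t $ i\<bar> \<le> vec_norm \<infinity> t"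
  by (simp add: vec_norm_def)

lemma vec_norm_infinity_le:
  "(\<And>i. \<bar>t $ i\<bar> \<le> c) \<Longrightarrow> vec_norm \<infinity> t \<le> c"
  by (simp add: vec_norm_def)

lemma vec_norm_real: "vec_norm (ereal r) t = (\<Sum>i\<in>UNIV. \<bar>t $ i\<bar> powr r) powr (1 / r)"
  by (simp add: vec_norm_def)

lemma vec_norm_powr:
  assumes "0 < r"
  shows "vec_norm (ereal r) t powr r = (\<Sum>i\<in>UNIV. \<bar>t $ i\<bar> powr r)"
  using assms by (simp add: vec_norm_real powr_powr sum_nonneg)

lemma vec_norm_eq_0_iff:
  assumes "0 < r"
  shows "vec_norm (ereal r) t = 0 \<longleftrightarrow> t = 0"
  by (simp add: vec_norm_real sum_nonneg_eq_0_iff vec_eq_iff)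

lemma vec_norm_scaleR:
  assumes "0 < r"
  shows "vec_norm r (c *\<^sub>R t) = \<bar>c\<bar> * vec_norm r t"
proof (cases r)
  case (real x)
  then show ?thesis using assms
    by (simp add: vec_norm_real abs_mult powr_mult powr_powr sum_nonneg flip: sum_distrib_left)
next
  case PInf
  have "mono (\<lambda>x. \<bar>c\<bar> * x)" by (simp add: monoI mult_left_mono)
  from mono_Max_commute[OF this, of "range (\<lambda>i. \<bar>t $ i\<bar>)"] show ?thesis
    by (simp add: PInf vec_norm_def image_image abs_mult)
qed (use assms in auto)

text \<open>Nonzero vectors are scaled to norm 1, and summing Young's inequality gives the bound
  \<open>1 / q + 1 / p = 1\<close>. For infinite \<open>p\<close>, \<open>q = 1\<close> and the
  maximum bounds each entry of \<open>t\<close>.\<close>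

lemma vec_norm_holder:
  assumes p: "1 \<le> p" and q: "1 \<le> q" and conj: "1 / p + 1 / ereal q = 1"
  shows "(\<Sum>i\<in>UNIV. \<bar>s $ i\<bar> * \<bar>t $ i\<bar>) \<le> vec_norm (ereal q) s * vec_norm p t"
proof (cases p)
  case (real x)
  have x0: "0 < x" using p real by simp
  have xq: "1 / x + 1 / q = 1" using conj real x0 q by (simp add: one_ereal_def)
  have "1 / q > 0" "1 / x > 0" using x0 q by simp_all
  then have "1 / x < 1" "1 / q < 1" using xq by linarith+
  then have gt: "1 < x" "1 < q" using x0 q by (simp_all add: divide_less_eq)
  define S where "S = vec_norm (ereal q) s"
  define T where "T = vec_norm p t"
  show ?thesis
  proof (cases "s = 0 \<or> t = 0")
    case True
    then show ?thesis by (auto simp: vec_norm_nonneg)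
  next
    case False
    then have ST: "0 < S" "0 < T"
      using vec_norm_eq_0_iff[of q s] vec_norm_eq_0_iff[of x t] vec_norm_nonneg[of q s] vec_norm_nonneg[of x t] gt
      by (auto simp: S_def T_def real less_le)
    have "(\<Sum>i\<in>UNIV. (\<bar>s $ i\<bar> / S) * (\<bar>t $ i\<bar> / T))
       \<le> (\<Sum>i\<in>UNIV. (\<bar>s $ i\<bar> / S) powr q / q + (\<bar>t $ i\<bar> / T) powr x / x)"
      using gt xq ST by (intro sum_mono Youngs_inequality) auto
    also have "\<dots> = (\<Sum>i\<in>UNIV. \<bar>s $ i\<bar> powr q) / S powr q / q + (\<Sum>i\<in>UNIV. \<bar>t $ i\<bar> powr x) / T powr x / x"
      using ST by (simp add: sum.distrib powr_divide sum_divide_distrib)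
    also have "\<dots> = 1 / q + 1 / x"
    proof -
      have "(\<Sum>i\<in>UNIV. \<bar>s $ i\<bar> powr q) = S powr q" "(\<Sum>i\<in>UNIV. \<bar>t $ i\<bar> powr x) = T powr x"
        unfolding S_def T_def real using gt by (simp_all add: vec_norm_powr)
      then show ?thesis using ST by simp
    qed
    finally have "(\<Sum>i\<in>UNIV. \<bar>s $ i\<bar> * \<bar>t $ i\<bar>) / (S * T) \<le> 1"
      using xq by (simp add: sum_divide_distrib)
    then show ?thesis using ST by (simp add: S_def T_def divide_le_eq)
  qed
next
  case PInf
  then have "q = 1" using conj q by (simp add: one_ereal_def)
  have "(\<Sum>i\<in>UNIV. \<bar>s $ i\<bar> * \<bar>t $ i\<bar>) \<le> (\<Sum>i\<in>UNIV. \<bar>s $ i\<bar> * vec_norm \<infinity> t)"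
    by (intro sum_mono mult_left_mono abs_le_vec_norm_infinity) simp
  then show ?thesis using \<open>q = 1\<close> by (simp add: PInf vec_norm_real sum_nonneg flip: sum_distrib_right)
qed (use p in auto)

text \<open>\<open>powr_convex\<close> settles positive arguments. If one argument is 0, the claim
  reduces to \<open>v powr a \<le> v\<close> for \<open>0 < v < 1\<close>.\<close>

lemma convex_on_powr_nonneg:
  assumes "1 \<le> a"
  shows "convex_on {0..} (\<lambda>x. x powr a)"
proof (rule convex_onI)
  fix u x y :: real
  assume u: "0 < u" "u < 1" and xy: "x \<in> {0..}" "y \<in> {0..}"
  have small: "(v * z) powr a \<le> v * z powr a" if "0 < v" "v < 1" "0 \<le> z" for v z :: real
  proof -
    have "v powr a \<le> v powr 1" using that assms by (intro powr_mono') auto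
    then show ?thesis using that by (simp add: powr_mult mult_right_mono)
  qed
  show "((1 - u) *\<^sub>R x + u *\<^sub>R y) powr a \<le> (1 - u) * x powr a + u * y powr a"
  proof (cases "x = 0 \<or> y = 0")
    case True
    then show ?thesis using small[of u y] small[of "1 - u" x] u xy assms by auto
  next
    case False
    then show ?thesis
      using convex_onD[OF powr_convex[OF assms], of u x y] u xy by simp
  qed
qed simp

text \<open>Jensen's inequality for \<open>z powr (p / 2)\<close>, convex because
  \<open>p \<ge> 2\<close>, bounds each \<open>\<bar>b $ i\<bar> powr p\<close> by a row average;
  the column sums then collapse the double sum. For infinite \<open>p\<close>, an average of squares
  is at most the largest square.\<close>

lemma vec_norm_le_doubly_stochastic:
  assumes p: "2 \<le> p" and c: "\<And>i j. 0 \<le> c i j" and row: "\<And>i. (\<Sum>j\<in>UNIV. c i j) = 1"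
    and col: "\<And>j. (\<Sum>i\<in>UNIV. c i j) = 1"
    and b: "\<And>i. (b $ i)\<^sup>2 = (\<Sum>j\<in>UNIV. c i j * (t $ j)\<^sup>2)"
  shows "vec_norm p b \<le> vec_norm p t"
proof (cases p)
  case (real x)
  then have x: "2 \<le> x" using p by simp
  have sq: "\<bar>z\<bar> powr x = (z\<^sup>2) powr (x / 2)" for z
    using powr_powr[of "\<bar>z\<bar>" 2 "x / 2"] by (cases "z = 0") simp_all
  have "(\<Sum>i\<in>UNIV. \<bar>b $ i\<bar> powr x) \<le> (\<Sum>i\<in>UNIV. \<Sum>j\<in>UNIV. c i j * \<bar>t $ j\<bar> powr x)"
  proof (rule sum_mono)
    fix i
    have "\<bar>b $ i\<bar> powr x = (\<Sum>j\<in>UNIV. c i j *\<^sub>R (t $ j)\<^sup>2) powr (x / 2)"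
      by (simp add: sq b)
    also have "\<dots> \<le> (\<Sum>j\<in>UNIV. c i j * ((t $ j)\<^sup>2) powr (x / 2))"
      using x c row by (intro convex_on_sum[OF _ _ convex_on_powr_nonneg]) auto
    finally show "\<bar>b $ i\<bar> powr x \<le> (\<Sum>j\<in>UNIV. c i j * \<bar>t $ j\<bar> powr x)" by (simp add: sq)
  qed
  also have "\<dots> = (\<Sum>j\<in>UNIV. \<bar>t $ j\<bar> powr x)"
    by (subst sum.swap) (simp add: col flip: sum_distrib_right)
  finally show ?thesis
    using x by (simp add: real vec_norm_real powr_mono2 sum_nonneg)
next
  case PInf
  have "\<bar>b $ i\<bar> \<le> vec_norm \<infinity> t" for i
  proof -
    have "(b $ i)\<^sup>2 \<le> (\<Sum>j\<in>UNIV. c i j * (vec_norm \<infinity> t)\<^sup>2)"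
      unfolding b using abs_le_vec_norm_infinity[of t]
      by (intro sum_mono mult_left_mono c) (simp add: abs_le_square_iff[symmetric] vec_norm_nonneg)
    also have "\<dots> = (vec_norm \<infinity> t)\<^sup>2" by (simp add: row flip: sum_distrib_right)
    finally show ?thesis by (simp add: vec_norm_nonneg flip: abs_le_square_iff)
  qed
  then show ?thesis unfolding PInf by (rule vec_norm_infinity_le)
qed (use p in auto)

subsection \<open>The Hoelder inequality for Schatten norms\<close>

lemma trace_inner_eq_inner: "trace_inner A B = A \<bullet> B"
proof -
  have "trace_inner A B = (\<Sum>j\<in>UNIV. \<Sum>i\<in>UNIV. A $ i $ j * B $ i $ j)"
    by (simp add: trace_inner_def trace_def matrix_matrix_mult_def transpose_def)
  also have "\<dots> = A \<bullet> B" by (subst sum.swap) (simp add: inner_vec_def)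
  finally show ?thesis .
qed

text \<open>Insert \<open>V ** transpose V = mat 1\<close> and rotate the trace: the inner product
  can be evaluated in any orthonormal basis.\<close>

lemma trace_inner_orthogonal:
  fixes A B :: "real ^ 'n ^ 'm"
  assumes "orthogonal_matrix V"
  shows "trace_inner A B = (\<Sum>i\<in>UNIV. column i (A ** V) \<bullet> column i (B ** V))"
proof -
  have "trace_inner A B = trace (transpose A ** (B ** (V ** transpose V)))"
    by (simp add: trace_inner_def orthogonal_matrix_cancel[OF assms])
  also have "\<dots> = trace (transpose (A ** V) ** (B ** V))"
    using trace_mul_sym[of "transpose A ** B ** V" "transpose V"]
    by (simp add: matrix_transpose_mul matrix_mul_assoc)
  finally show ?thesis
    by (simp add: trace_def matrix_matrix_mult_def transpose_def column_def inner_vec_def)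
qed

text \<open>The Gram matrix of \<open>A ** V\<close> is
  \<open>transpose Q ** diag_matrix (t * t) ** Q\<close> with \<open>Q = transpose U ** V\<close>;
  its diagonal entries are weighted sums of the squared singular values.\<close>

lemma gram_decomp_column:
  assumes "gram_decomp A U t" and V: "orthogonal_matrix V"
  shows "(norm (column i (A ** V)))\<^sup>2 = (\<Sum>j\<in>UNIV. ((transpose U ** V) $ j $ i)\<^sup>2 * (t $ j)\<^sup>2)"
proof -
  define Q where "Q = transpose U ** V"
  have "(norm (column i (A ** V)))\<^sup>2 = (transpose (A ** V) ** (A ** V)) $ i $ i"
    by (simp add: matrix_mult_transpose_dot_column power2_norm_eq_inner)
  also have "transpose (A ** V) ** (A ** V) = transpose V ** (transpose A ** A) ** V"
    by (simp add: matrix_transpose_mul matrix_mul_assoc)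
  also have "\<dots> = transpose Q ** (diag_matrix (t * t) ** Q)"
    using assms by (simp add: gram_decomp_def spectral_def Q_def matrix_transpose_mul matrix_mul_assoc)
  also have "\<dots> $ i $ i = (\<Sum>j\<in>UNIV. (Q $ j $ i)\<^sup>2 * (t $ j)\<^sup>2)"
    by (subst matrix_matrix_mult_def)
       (simp add: diag_matrix_mult_nth_left transpose_def power2_eq_square mult_ac)
  finally show ?thesis by (simp add: Q_def)
qed

text \<open>Read off from the diagonals of \<open>transpose Q ** Q\<close> and
  \<open>Q ** transpose Q\<close>; the squared entries thus form a doubly stochastic matrix.\<close>

lemma orthogonal_matrix_square_sums:
  fixes Q :: "real ^ 'n ^ 'n"
  assumes "orthogonal_matrix Q"
  shows "(\<Sum>i\<in>UNIV. (Q $ i $ j)\<^sup>2) = 1" "(\<Sum>i\<in>UNIV. (Q $ j $ i)\<^sup>2) = 1"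
proof -
  have "(transpose Q ** Q) $ j $ j = 1" "(Q ** transpose Q) $ j $ j = 1"
    using assms by (simp_all add: orthogonal_matrix_def mat_def)
  then show "(\<Sum>i\<in>UNIV. (Q $ i $ j)\<^sup>2) = 1" "(\<Sum>i\<in>UNIV. (Q $ j $ i)\<^sup>2) = 1"
    by (simp_all add: matrix_matrix_mult_def transpose_def power2_eq_square)
qed

text \<open>In an orthonormal eigenbasis \<open>v\<^sub>i\<close> of \<open>M\<^sup>T M\<close> the inner product is
  \<open>\<Sum>\<^sub>i \<langle>M v\<^sub>i, Z v\<^sub>i\<rangle>\<close> with \<open>\<bar>M v\<^sub>i\<bar> = s\<^sub>i\<close>. The squares \<open>\<bar>Z v\<^sub>i\<bar>\<^sup>2\<close> are averages of the squared
  singular values of \<open>Z\<close> with doubly stochastic weights; Jensen's inequality for \<open>x \<mapsto> x\<^bsup>p/2\<^esup>\<close>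
  is where \<open>p \<ge> 2\<close> enters.\<close>

theorem schatten_holder:
  fixes M Z :: "real ^ 'n ^ 'm"
  assumes p: "2 \<le> p" and q: "1 \<le> q" and conj: "1 / p + 1 / ereal q = 1"
  shows "\<bar>trace_inner M Z\<bar> \<le> schatten_norm (ereal q) M * schatten_norm p Z"
proof -
  obtain V s where M: "gram_decomp M V s" by (rule gram_decomp_exists)
  obtain W t where Z: "gram_decomp Z W t" by (rule gram_decomp_exists)
  have V: "orthogonal_matrix V" and W: "orthogonal_matrix W" using M Z by (auto simp: gram_decomp_def)
  define b where "b = (\<chi> i. norm (column i (Z ** V)))"
  define Q where "Q = transpose W ** V"
  have Q: "orthogonal_matrix Q"
    unfolding Q_def using V W by (intro orthogonal_matrix_mul) simp_all
  \<comment> \<open>Here the basis is the eigenbasis of the Gram matrix of \<open>M\<close> itself,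
    so the weights in \<open>gram_decomp_column\<close> form the identity matrix.\<close>
  have "(norm (column i (M ** V)))\<^sup>2 = (s $ i)\<^sup>2" for i
    using gram_decomp_column[OF M V, of i] orthogonal_matrix_cancel(1)[OF V]
    by (simp add: mat_def if_distrib if_distribR cong: if_cong)
  then have s: "norm (column i (M ** V)) = \<bar>s $ i\<bar>" for i
    by (metis abs_norm_cancel real_sqrt_abs)
  have "\<bar>trace_inner M Z\<bar> \<le> (\<Sum>i\<in>UNIV. \<bar>column i (M ** V) \<bullet> column i (Z ** V)\<bar>)"
    unfolding trace_inner_orthogonal[OF V] by (rule sum_abs)
  also have "\<dots> \<le> (\<Sum>i\<in>UNIV. \<bar>s $ i\<bar> * \<bar>b $ i\<bar>)"
    unfolding b_def s[symmetric] by (simp add: sum_mono Cauchy_Schwarz_ineq2)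
  also have "\<dots> \<le> vec_norm (ereal q) s * vec_norm p b"
    by (intro vec_norm_holder q conj order_trans[OF _ p]) simp
  also have "vec_norm p b \<le> vec_norm p t"
  proof (rule vec_norm_le_doubly_stochastic[OF p])
    show "(b $ i)\<^sup>2 = (\<Sum>j\<in>UNIV. (Q $ j $ i)\<^sup>2 * (t $ j)\<^sup>2)" for i
      by (simp add: b_def Q_def gram_decomp_column[OF Z V])
  qed (simp_all add: orthogonal_matrix_square_sums[OF Q])
  finally show ?thesis
    by (simp add: schatten_norm_gram[OF M] schatten_norm_gram[OF Z] vec_norm_nonneg mult_left_mono)
qed

subsection \<open>The minimizers\<close>

lemma schatten_norm_scaleR:
  assumes "0 < r"
  shows "schatten_norm r (c *\<^sub>R A) = \<bar>c\<bar> * schatten_norm r A"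
proof -
  obtain U t where A: "gram_decomp A U t" by (rule gram_decomp_exists)
  then show ?thesis
    using assms by (simp add: schatten_norm_gram[OF A] schatten_norm_gram[OF gram_decomp_scaleR[OF A]] vec_norm_scaleR)
qed

lemma schatten_norm_zero:
  assumes "0 < r"
  shows "schatten_norm r (0 :: real ^ 'n ^ 'm) = 0"
  using schatten_norm_scaleR[OF assms, of 0 "0 :: real ^ 'n ^ 'm"] by simp

lemma gram_decomp_eq_0:
  assumes "gram_decomp A U 0"
  shows "A = 0"
proof -
  have "transpose A ** A = 0"
    using assms scaleR_spectral[of 0 U 0] by (simp add: gram_decomp_def)
  then have "A \<bullet> A = 0" by (simp add: trace_inner_def trace_def flip: trace_inner_eq_inner)
  then show ?thesis by simp
qed

lemma schatten_norm_pos: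
  assumes "A \<noteq> 0" "0 < r"
  shows "0 < schatten_norm (ereal r) A"
proof -
  obtain U t where A: "gram_decomp A U t" by (rule gram_decomp_exists)
  then have "t \<noteq> 0" using gram_decomp_eq_0 assms by metis
  then show ?thesis
    using assms vec_norm_nonneg[of r t] by (simp add: schatten_norm_gram[OF A] vec_norm_eq_0_iff less_le)
qed

text \<open>Multiplying \<open>M\<close> by a function of its Gram matrix keeps the right singular
  vectors and scales each nonzero \<open>s $ i\<close> by \<open>s $ i powr (q - 2)\<close>. This
  yields the norm of the unnormalized minimizer and its inner product with \<open>M\<close>.\<close>

lemma gram_decomp_dual:
  assumes M: "gram_decomp M U s"
  shows "gram_decomp (M ** psd_pow (transpose M ** M) ((q - 2) / 2)) U (\<chi> i. s $ i powr (q - 1))"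
    and "trace_inner M (M ** psd_pow (transpose M ** M) ((q - 2) / 2)) = (\<Sum>i\<in>UNIV. s $ i powr q)"
proof -
  have U: "orthogonal_matrix U" and s: "\<And>i. 0 \<le> s $ i" and eq: "transpose M ** M = spectral U (s * s)"
    using M by (auto simp: gram_decomp_def)
  define g where "g = (\<chi> i. real_pow (s $ i * s $ i) ((q - 2) / 2))"
  have P: "psd_pow (transpose M ** M) ((q - 2) / 2) = spectral U g"
    using psd_pow_spectral[OF U, of "s * s" "(q - 2) / 2"] s by (simp add: eq g_def)
  have g: "s $ i * g $ i = s $ i powr (q - 1)" "s $ i * (s $ i * g $ i) = s $ i powr q" for i
  proof -
    \<comment> \<open>A zero singular value gives 0 on both sides whatever \<open>g $ i\<close> is;
      for \<open>q = 1\<close> this relies on \<open>0 powr 0 = 0\<close>.\<close>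
    have "s $ i * g $ i = s $ i powr (q - 1)"
    proof (cases "s $ i = 0")
      case False
      then have si: "0 < s $ i" using s[of i] by simp
      have "g $ i = s $ i powr (q - 2)"
        using si by (simp add: g_def real_pow_def powr_mult flip: powr_add)
      then show ?thesis using si powr_mult_base[of "s $ i" "q - 2"] by simp
    qed simp
    moreover have "s $ i * s $ i powr (q - 1) = s $ i powr q"
      using powr_mult_base[OF s, of i "q - 1"] by simp
    ultimately show "s $ i * g $ i = s $ i powr (q - 1)" "s $ i * (s $ i * g $ i) = s $ i powr q"
      by simp_all
  qed
  have "transpose (M ** spectral U g) ** (M ** spectral U g) = spectral U g ** spectral U (s * s) ** spectral U g"
    by (simp add: matrix_transpose_mul matrix_mul_assoc flip: eq)
  also have "\<dots> = spectral U ((\<chi> i. s $ i powr (q - 1)) * (\<chi> i. s $ i powr (q - 1)))"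
    by (simp add: spectral_mult[OF U] g(1)[symmetric]) (rule arg_cong[where f = "spectral U"], simp add: vec_eq_iff mult_ac)
  finally show "gram_decomp (M ** psd_pow (transpose M ** M) ((q - 2) / 2)) U (\<chi> i. s $ i powr (q - 1))"
    by (simp add: gram_decomp_def U P)
  have "trace_inner M (M ** spectral U g) = trace (spectral U (s * s) ** spectral U g)"
    by (simp add: trace_inner_def matrix_mul_assoc eq)
  also have "\<dots> = (\<Sum>i\<in>UNIV. s $ i powr q)"
    by (simp add: spectral_mult[OF U] trace_spectral[OF U] g(2) mult.assoc)
  finally show "trace_inner M (M ** psd_pow (transpose M ** M) ((q - 2) / 2)) = (\<Sum>i\<in>UNIV. s $ i powr q)"
    by (simp add: P)
qed

text \<open>Conjugacy with finite \<open>p\<close> gives \<open>(q - 1) * p = q\<close>, so both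
  norms come from the same sum of \<open>q\<close>-th powers, as in the equality case of Hoelder's
  inequality.\<close>

lemma vec_norm_dual:
  assumes p: "1 \<le> p" and q: "1 \<le> q" and conj: "1 / p + 1 / ereal q = 1"
    and s: "\<And>i. 0 \<le> s $ i" "s \<noteq> 0"
  shows "vec_norm p (\<chi> i. s $ i powr (q - 1)) = vec_norm (ereal q) s powr (q - 1)"
proof (cases p)
  case (real x)
  have x0: "0 < x" using p real by simp
  have "1 / x + 1 / q = 1" using conj real x0 q by (simp add: one_ereal_def)
  then have xq: "(q - 1) * x = q" using x0 q by (simp add: field_simps)
  have "vec_norm p (\<chi> i. s $ i powr (q - 1)) = (\<Sum>i\<in>UNIV. \<bar>s $ i\<bar> powr q) powr (1 / x)"
    using s by (simp add: real vec_norm_real powr_powr xq)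
  also have "\<dots> = vec_norm (ereal q) s powr (q / x)"
    using q by (simp add: powr_powr flip: vec_norm_powr)
  also have "q / x = q - 1" using xq x0 by (simp add: field_simps)
  finally show ?thesis .
next
  case PInf
  then have q1: "q = 1" using conj q by (simp add: one_ereal_def)
  \<comment> \<open>The entries \<open>s $ i powr 0\<close> are 0 or 1, and a nonzero
    \<open>s\<close> produces at least one 1; both sides of the claim are then 1.\<close>
  obtain i where "s $ i \<noteq> 0" using s(2) by (auto simp: vec_eq_iff)
  then have "Max (range (\<lambda>i. s $ i powr 0)) = 1"
    by (intro Max_eqI) (auto intro!: image_eqI[of _ _ i])
  moreover have "vec_norm (ereal 1) s \<noteq> 0" using s(2) by (simp add: vec_norm_eq_0_iff)
  ultimately show ?thesis by (simp add: PInf q1 vec_norm_def[of \<infinity>])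
qed (use p in auto)

theorem lemma1:
  fixes M :: "real ^ 'n ^ 'm" and p :: ereal and q :: real
  assumes "p \<in> {2..\<infinity>}" and "q \<in> {1..2}" and "1 / p + 1 / ereal q = 1"
  shows
    "(M = 0 \<longrightarrow>
        is_arg_min (\<lambda>Z. trace_inner M Z) (\<lambda>Z. schatten_norm p Z \<le> 1) 0 \<and>
        is_arg_min (\<lambda>Z. trace_inner M Z + 1 / 2 * (schatten_norm p Z)\<^sup>2) (\<lambda>_. True) 0) \<and>
     (M \<noteq> 0 \<longrightarrow>
        (let Zb = - ((M ** psd_pow (transpose M ** M) ((q - 2) / 2))
                      /\<^sub>R (schatten_norm (ereal q) M powr (q - 1)));
             Zr = schatten_norm (ereal q) M *\<^sub>R Zb
         in is_arg_min (\<lambda>Z. trace_inner M Z) (\<lambda>Z. schatten_norm p Z \<le> 1) Zb \<and>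
            is_arg_min (\<lambda>Z. trace_inner M Z + 1 / 2 * (schatten_norm p Z)\<^sup>2) (\<lambda>_. True) Zr))"
proof (rule conjI; rule impI)
  have p: "2 \<le> p" and q: "1 \<le> q" using assms by auto
  have p1: "1 \<le> p" and p0: "0 < p" by (rule order_trans[OF _ p] less_le_trans[OF _ p], simp)+
  {
    assume "M = 0"
    then show "is_arg_min (\<lambda>Z. trace_inner M Z) (\<lambda>Z. schatten_norm p Z \<le> 1) 0 \<and>
      is_arg_min (\<lambda>Z. trace_inner M Z + 1 / 2 * (schatten_norm p Z)\<^sup>2) (\<lambda>_. True) 0"
      by (simp add: is_arg_min_linorder trace_inner_eq_inner schatten_norm_zero[OF p0])
  }
  assume "M \<noteq> 0"
  define N where "N = schatten_norm (ereal q) M"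
  define D where "D = M ** psd_pow (transpose M ** M) ((q - 2) / 2)"
  define Zb where "Zb = - (D /\<^sub>R (N powr (q - 1)))"
  have N: "0 < N" unfolding N_def using \<open>M \<noteq> 0\<close> q by (intro schatten_norm_pos) auto
  obtain U s where M: "gram_decomp M U s" by (rule gram_decomp_exists)
  have s: "\<And>i. 0 \<le> s $ i" using M by (auto simp: gram_decomp_def)
  have s0: "s \<noteq> 0" using M \<open>M \<noteq> 0\<close> gram_decomp_eq_0 by blast
  have Ns: "N = vec_norm (ereal q) s" by (simp add: N_def schatten_norm_gram[OF M])
  have "schatten_norm p D = N powr (q - 1)"
    unfolding D_def schatten_norm_gram[OF gram_decomp_dual(1)[OF M]] Ns
    by (rule vec_norm_dual[OF p1 q assms(3) s s0])
  moreover have Zb_eq: "Zb = (- inverse (N powr (q - 1))) *\<^sub>R D" by (simp add: Zb_def)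
  ultimately have norm_Zb: "schatten_norm p Zb = 1"
    using N by (simp only: Zb_eq schatten_norm_scaleR[OF p0]) simp
  have "trace_inner M D = N powr q"
    unfolding D_def gram_decomp_dual(2)[OF M] Ns using q s by (simp add: vec_norm_powr)
  also have "\<dots> = N * N powr (q - 1)" using N powr_mult_base[of N "q - 1"] by simp
  finally have inner_Zb: "trace_inner M Zb = - N"
    using N by (simp add: Zb_eq trace_inner_eq_inner)
  have holder: "- (N * schatten_norm p Z) \<le> trace_inner M Z" for Z
    using schatten_holder[OF p q assms(3), of M Z] by (simp add: N_def)
  have ball: "is_arg_min (\<lambda>Z. trace_inner M Z) (\<lambda>Z. schatten_norm p Z \<le> 1) Zb"
    unfolding is_arg_min_linorder
  proof (intro conjI allI impI)
    show "trace_inner M Zb \<le> trace_inner M Z" if "schatten_norm p Z \<le> 1" for Z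
      using holder[of Z] mult_left_le[OF that less_imp_le[OF N]] by (simp add: inner_Zb)
  qed (simp add: norm_Zb)
  have reg: "is_arg_min (\<lambda>Z. trace_inner M Z + 1 / 2 * (schatten_norm p Z)\<^sup>2) (\<lambda>_. True) (N *\<^sub>R Zb)"
    unfolding is_arg_min_linorder
  proof (intro conjI allI impI TrueI)
    fix Z :: "real ^ 'n ^ 'm"
    have "trace_inner M (N *\<^sub>R Zb) + 1 / 2 * (schatten_norm p (N *\<^sub>R Zb))\<^sup>2 = - (N\<^sup>2 / 2)"
      using inner_Zb N by (simp add: trace_inner_eq_inner schatten_norm_scaleR[OF p0] norm_Zb power2_eq_square)
    \<comment> \<open>Completing the square: the two sides differ by
      \<open>(N - schatten_norm p Z)\<^sup>2 / 2\<close>.\<close>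
    also have "\<dots> \<le> - (N * schatten_norm p Z) + 1 / 2 * (schatten_norm p Z)\<^sup>2"
      using zero_le_power2[of "N - schatten_norm p Z"] by (simp add: power2_diff)
    also have "\<dots> \<le> trace_inner M Z + 1 / 2 * (schatten_norm p Z)\<^sup>2"
      using holder[of Z] by simp
    finally show "trace_inner M (N *\<^sub>R Zb) + 1 / 2 * (schatten_norm p (N *\<^sub>R Zb))\<^sup>2
      \<le> trace_inner M Z + 1 / 2 * (schatten_norm p Z)\<^sup>2" .
  qed
  show "let Zb = - ((M ** psd_pow (transpose M ** M) ((q - 2) / 2))
                      /\<^sub>R (schatten_norm (ereal q) M powr (q - 1)));
             Zr = schatten_norm (ereal q) M *\<^sub>R Zb
         in is_arg_min (\<lambda>Z. trace_inner M Z) (\<lambda>Z. schatten_norm p Z \<le> 1) Zb \<and>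
            is_arg_min (\<lambda>Z. trace_inner M Z + 1 / 2 * (schatten_norm p Z)\<^sup>2) (\<lambda>_. True) Zr"
    using ball reg unfolding Let_def Zb_def D_def N_def by blast
qed

end
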